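(* Let $N$ be a right Hilbert $C^*$-module over a $C^*$-algebra $A$ and let $M\subset N$ be a closed submodule. Let $J_M=\{T\in\mathbb K(N):\operatorname{Ran}T\subset M\}$, a closed right ideal of $\mathbb K(N)$. Then: 1. $M$ is essential in $N$ if and only if $J_M$ is essential in $\mathbb K(N)$. 2. $M$ is thick in $N$ if and only if $J_M$ is thick in $\mathbb K(N)$.
   Context: $\mathbb K(N)$ is the $C^*$-algebra of compact operators on $N$: for $x,y\in N$ let $\theta_{x,y}(z)=x\langle y,z\rangle$; $\mathbb K(N)$ is the norm closure of the linear span of the operators $\theta_{x,y}$ in the bounded maps $N\to N$. For a closed submodule $M\subset N$: $M$ is essential in $N$ if $M\cap K\neq 0$ for every (not necessarily closed) non-zero submodule $K\subset N$; $M$ is thick in $N$ if $\{n\in N:\langle n,m\rangle=0\ \forall m\in M\}=0$. For a closed right ideal $J$ in a $C^*$-algebra $B$: $J$ is essential in $B$ if $J\cap I\neq 0$ for every (not necessarily closed) non-zero right ideal $I\subset B$ (equivalently: for each non-zero $a\in B$ there is $b\in B$ with $ab\in J$ and $ab\neq 0$); $J$ is thick in $B$ if, for $a\in B$, $aJ=0$ (i.e. $ax=0$ for all $x\in J$) implies $a=0$. *)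

theory Defs
  imports "HOL-Analysis.Analysis"
begin

section \<open>Complex normed spaces\<close>

class complex_vector = real_vector +
  fixes scaleC :: "complex \<Rightarrow> 'a \<Rightarrow> 'a" (infixr "*\<^sub>C" 75)
  assumes scaleR_scaleC: "r *\<^sub>R x = complex_of_real r *\<^sub>C x"
    and scaleC_add_right: "c *\<^sub>C (x + y) = c *\<^sub>C x + c *\<^sub>C y"
    and scaleC_add_left: "(c + d) *\<^sub>C x = c *\<^sub>C x + d *\<^sub>C x"
    and scaleC_scaleC: "c *\<^sub>C d *\<^sub>C x = (c * d) *\<^sub>C x"

lemma scaleC_one: "1 *\<^sub>C x = (x :: 'a::complex_vector)"
  using scaleR_scaleC[of 1 x] by simp

global_interpretation complex_vector: vector_space "scaleC :: complex \<Rightarrow> 'a \<Rightarrow> 'a::complex_vector"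
  by unfold_locales (auto simp: scaleC_add_right scaleC_add_left scaleC_scaleC scaleC_one)

class complex_normed_vector = complex_vector + real_normed_vector +
  assumes norm_scaleC: "norm (c *\<^sub>C x) = cmod c * norm x"

class complex_banach = complex_normed_vector + complete_space

lemma bounded_linear_scaleC: "bounded_linear ((*\<^sub>C) c :: 'a \<Rightarrow> 'a::complex_normed_vector)"
  by (rule bounded_linear_intro[where K = "cmod c"])
    (auto simp: scaleC_add_right norm_scaleC scaleR_scaleC scaleC_scaleC mult.commute)

text \<open>
  The library type \<open>'a \<Rightarrow>\<^sub>L 'b\<close> consists of the bounded real-linear maps. For complex normed spaces
  the complex-linear ones form a closed subspace of it, with the same operator norm. Hence a norm
  closure of a set of complex-linear maps does not depend on which of the two spaces it is taken in.
\<close>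

instantiation blinfun :: (real_normed_vector, complex_normed_vector) complex_normed_vector
begin

lift_definition scaleC_blinfun :: "complex \<Rightarrow> 'a \<Rightarrow>\<^sub>L 'b \<Rightarrow> 'a \<Rightarrow>\<^sub>L 'b"
  is "\<lambda>c f x. c *\<^sub>C f x"
  by (rule bounded_linear_compose[OF bounded_linear_scaleC])

instance
proof
  fix r :: real and c d :: complex and f g :: "'a \<Rightarrow>\<^sub>L 'b"
  show "r *\<^sub>R f = complex_of_real r *\<^sub>C f"
    by transfer (simp add: scaleR_scaleC)
  show "c *\<^sub>C (f + g) = c *\<^sub>C f + c *\<^sub>C g"
    by transfer (simp add: scaleC_add_right)
  show "(c + d) *\<^sub>C f = c *\<^sub>C f + d *\<^sub>C f"
    by transfer (simp add: scaleC_add_left)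
  show "c *\<^sub>C d *\<^sub>C f = (c * d) *\<^sub>C f"
    by transfer (simp add: scaleC_scaleC)
  have le: "norm (c *\<^sub>C f) \<le> cmod c * norm f" for c and f :: "'a \<Rightarrow>\<^sub>L 'b"
  proof (rule norm_blinfun_bound)
    show "norm (blinfun_apply (c *\<^sub>C f) x) \<le> cmod c * norm f * norm x" for x
      using mult_left_mono[OF norm_blinfun[of f x] norm_ge_zero[of c]]
      by (simp add: scaleC_blinfun.rep_eq norm_scaleC mult.assoc)
  qed simp
  show "norm (c *\<^sub>C f) = cmod c * norm f"
  proof (cases "c = 0")
    case True
    then show ?thesis using le[of 0 f] by simp
  next
    case False
    have "f = inverse c *\<^sub>C c *\<^sub>C f"
      using False by transfer (simp add: scaleC_scaleC scaleC_one)
    then have "norm f \<le> inverse (cmod c) * norm (c *\<^sub>C f)"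
      using le[of "inverse c" "c *\<^sub>C f"] by (simp add: norm_inverse)
    then have "cmod c * norm f \<le> norm (c *\<^sub>C f)"
      using False by (simp add: field_simps)
    with le[of c f] show ?thesis by simp
  qed
qed

end


section \<open>C*-algebras and their right ideals\<close>

text \<open>C*-algebras need not be unital.\<close>

class cstar_algebra = complex_banach + real_normed_algebra +
  fixes star :: "'a \<Rightarrow> 'a"
  assumes mult_scaleC_left: "(c *\<^sub>C a) * b = c *\<^sub>C (a * b)"
    and mult_scaleC_right: "a * (c *\<^sub>C b) = c *\<^sub>C (a * b)"
    and star_add: "star (a + b) = star a + star b"
    and star_scaleC: "star (c *\<^sub>C a) = cnj c *\<^sub>C star a"
    and star_mult: "star (a * b) = star b * star a"
    and star_star: "star (star a) = a"
    and cstar_identity: "norm (star a * a) = (norm a)\<^sup>2"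

definition cstar_positive :: "'a::cstar_algebra \<Rightarrow> bool" where
  "cstar_positive a \<longleftrightarrow> (\<exists>b. a = star b * b)"

text \<open>
  The algebra \<open>K(N)\<close> below is a set of operators rather than a type, so ideals are relative to a
  carrier \<open>B\<close> inside a complex normed space, with multiplication \<open>mul\<close>.
\<close>

definition right_ideal :: "('b \<Rightarrow> 'b \<Rightarrow> 'b) \<Rightarrow> 'b::complex_normed_vector set \<Rightarrow> 'b set \<Rightarrow> bool" where
  "right_ideal mul B I \<longleftrightarrow>
     I \<subseteq> B \<and> complex_vector.subspace I \<and> (\<forall>x\<in>I. \<forall>b\<in>B. mul x b \<in> I)"

definition essential_right_ideal ::
  "('b \<Rightarrow> 'b \<Rightarrow> 'b) \<Rightarrow> 'b::complex_normed_vector set \<Rightarrow> 'b set \<Rightarrow> bool" where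
  "essential_right_ideal mul B J \<longleftrightarrow> (\<forall>I. right_ideal mul B I \<and> I \<noteq> {0} \<longrightarrow> J \<inter> I \<noteq> {0})"

definition thick_right_ideal ::
  "('b \<Rightarrow> 'b \<Rightarrow> 'b) \<Rightarrow> 'b::complex_normed_vector set \<Rightarrow> 'b set \<Rightarrow> bool" where
  "thick_right_ideal mul B J \<longleftrightarrow> (\<forall>a\<in>B. (\<forall>x\<in>J. mul a x = 0) \<longrightarrow> a = 0)"


section \<open>Hilbert modules and their submodules\<close>

text \<open>
  The inner product is linear in its second argument. By \<open>norm_ip\<close> the Hilbert module norm is
  the norm of the type \<open>'n\<close>, so the class \<open>complex_banach\<close> provides completeness.
\<close>

locale hilbert_module =
  fixes act :: "'n::complex_banach \<Rightarrow> 'a::cstar_algebra \<Rightarrow> 'n"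
    and ip :: "'n \<Rightarrow> 'n \<Rightarrow> 'a"
  assumes act_add_left: "act (x + y) a = act x a + act y a"
    and act_add_right: "act x (a + b) = act x a + act x b"
    and act_mult: "act x (a * b) = act (act x a) b"
    and act_scaleC_left: "act (c *\<^sub>C x) a = c *\<^sub>C act x a"
    and act_scaleC_right: "act x (c *\<^sub>C a) = c *\<^sub>C act x a"
    and ip_add_right: "ip x (y + z) = ip x y + ip x z"
    and ip_scaleC_right: "ip x (c *\<^sub>C y) = c *\<^sub>C ip x y"
    and ip_act_right: "ip x (act y a) = ip x y * a"
    and star_ip: "star (ip x y) = ip y x"
    and ip_positive: "cstar_positive (ip x x)"
    and ip_definite: "ip x x = 0 \<Longrightarrow> x = 0"
    and norm_ip: "norm x = sqrt (norm (ip x x))"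

definition submodule :: "('n::complex_banach \<Rightarrow> 'a::cstar_algebra \<Rightarrow> 'n) \<Rightarrow> 'n set \<Rightarrow> bool" where
  "submodule act K \<longleftrightarrow> complex_vector.subspace K \<and> (\<forall>x\<in>K. \<forall>a. act x a \<in> K)"

definition essential_submodule ::
  "('n::complex_banach \<Rightarrow> 'a::cstar_algebra \<Rightarrow> 'n) \<Rightarrow> 'n set \<Rightarrow> bool" where
  "essential_submodule act M \<longleftrightarrow> (\<forall>K. submodule act K \<and> K \<noteq> {0} \<longrightarrow> M \<inter> K \<noteq> {0})"

definition thick_submodule ::
  "('n::complex_banach \<Rightarrow> 'n \<Rightarrow> 'a::cstar_algebra) \<Rightarrow> 'n set \<Rightarrow> bool" where
  "thick_submodule ip M \<longleftrightarrow> {n. \<forall>m\<in>M. ip n m = 0} = {0}"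


section \<open>Compact operators\<close>

definition theta ::
  "('n::complex_banach \<Rightarrow> 'a::cstar_algebra \<Rightarrow> 'n) \<Rightarrow> ('n \<Rightarrow> 'n \<Rightarrow> 'a) \<Rightarrow> 'n \<Rightarrow> 'n \<Rightarrow> 'n \<Rightarrow>\<^sub>L 'n" where
  "theta act ip x y = Blinfun (\<lambda>z. act x (ip y z))"

definition compact_operators ::
  "('n::complex_banach \<Rightarrow> 'a::cstar_algebra \<Rightarrow> 'n) \<Rightarrow> ('n \<Rightarrow> 'n \<Rightarrow> 'a) \<Rightarrow> ('n \<Rightarrow>\<^sub>L 'n) set" where
  "compact_operators act ip = closure (complex_vector.span {theta act ip x y | x y. True})"

definition operators_into ::
  "('n::complex_banach \<Rightarrow> 'a::cstar_algebra \<Rightarrow> 'n) \<Rightarrow> ('n \<Rightarrow> 'n \<Rightarrow> 'a) \<Rightarrow> 'n set \<Rightarrow> ('n \<Rightarrow>\<^sub>L 'n) set"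
  where
  "operators_into act ip M = {T \<in> compact_operators act ip. range (blinfun_apply T) \<subseteq> M}"


text \<open>
  The maps \<open>\<lambda>z. act x (ip y z)\<close> are bounded, so \<open>Blinfun\<close> is applied to them in its intended range.
\<close>

lemma norm_star: "norm (star a) = norm (a :: 'a::cstar_algebra)"
proof -
  have le: "norm a \<le> norm (star a)" for a :: 'a
  proof (cases "a = 0")
    case False
    have "norm a * norm a \<le> norm (star a) * norm a"
      using cstar_identity[of a] norm_mult_ineq[of "star a" a] by (simp add: power2_eq_square)
    with False show ?thesis by simp
  qed simp
  show ?thesis using le[of a] le[of "star a"] by (simp add: star_star)
qed

context hilbert_module
begin

lemma ip_add_left: "ip (x + y) z = ip x z + ip y z"
  by (metis star_ip ip_add_right star_add)

lemma ip_scaleC_left: "ip (c *\<^sub>C x) y = cnj c *\<^sub>C ip x y"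
  by (metis star_ip ip_scaleC_right star_scaleC)

lemma norm_ip_self: "norm (ip x x) = (norm x)\<^sup>2"
  by (simp add: norm_ip)

lemma norm_act_le: "norm (act x a) \<le> norm x * norm a"
proof -
  have "ip (act x a) (act x a) = star a * (ip x x * a)"
    by (metis ip_act_right mult.assoc star_ip star_mult)
  then have "(norm (act x a))\<^sup>2 \<le> norm a * norm (ip x x * a)"
    by (metis norm_ip_self norm_mult_ineq norm_star)
  also have "\<dots> \<le> norm a * ((norm x)\<^sup>2 * norm a)"
    by (metis mult_left_mono norm_ge_zero norm_ip_self norm_mult_ineq)
  finally have "(norm (act x a))\<^sup>2 \<le> (norm x * norm a)\<^sup>2"
    by (simp add: power2_eq_square algebra_simps)
  then show ?thesis by (rule power2_le_imp_le) simp
qed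

lemma polarization:
  "4 *\<^sub>C ip x y = (ip (x + y) (x + y) - ip (x - y) (x - y))
     - \<i> *\<^sub>C (ip (x + \<i> *\<^sub>C y) (x + \<i> *\<^sub>C y) - ip (x - \<i> *\<^sub>C y) (x - \<i> *\<^sub>C y))"
proof -
  have expand: "ip (x + z) (x + z) - ip (x - z) (x - z) = 2 *\<^sub>C (ip x z + ip z x)" for z
  proof -
    have m: "x - z = x + (-1) *\<^sub>C z" by simp
    have "(2::complex) = 1 + 1" by simp
    then show ?thesis
      unfolding m ip_add_left ip_add_right ip_scaleC_left ip_scaleC_right
      by (simp only: scaleC_add_left scaleC_one) (simp add: scaleC_add_right)
  qed
  have "(4::complex) = 2 + 2" by simp
  then show ?thesis
    unfolding expand ip_scaleC_left ip_scaleC_right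
    by (simp only: scaleC_add_left scaleC_add_right scaleC_scaleC)
      (simp add: algebra_simps flip: scaleC_add_left)
qed

lemma norm_ip_le: "norm (ip x y) \<le> 4 * norm x * norm y"
proof -
  have le4: "norm (ip x y) \<le> 4" if "norm x = 1" "norm y = 1" for x y
  proof -
    have q: "norm (ip (x + z) (x + z)) \<le> 4" if "norm z = 1" for z
      unfolding norm_ip_self
      using power_mono[OF norm_triangle_ineq[of x z], of 2] that \<open>norm x = 1\<close> by simp
    have d: "norm (ip (x + z) (x + z) - ip (x - z) (x - z)) \<le> 8" if "norm z = 1" for z
      using norm_triangle_ineq4[of "ip (x + z) (x + z)" "ip (x - z) (x - z)"] q[of z] q[of "- z"] that
      by simp
    have "norm (4 *\<^sub>C ip x y) \<le> 8 + 8"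
      unfolding polarization
      by (rule order_trans[OF norm_triangle_ineq4 add_mono])
        (use d[of y] d[of "\<i> *\<^sub>C y"] \<open>norm y = 1\<close> in \<open>simp_all add: norm_scaleC\<close>)
    then show ?thesis by (simp add: norm_scaleC)
  qed
  have ip0: "ip 0 y = 0" "ip x 0 = 0" for x y
    using ip_add_left[of 0 0 y] ip_add_right[of x 0 0] by simp_all
  show ?thesis
  proof (cases "x = 0 \<or> y = 0")
    case True
    then show ?thesis by (auto simp: ip0)
  next
    case False
    let ?c = "complex_of_real (inverse (norm x))" and ?d = "complex_of_real (inverse (norm y))"
    have "norm (ip (?c *\<^sub>C x) (?d *\<^sub>C y)) \<le> 4"
      by (rule le4) (use False in \<open>simp_all add: norm_scaleC norm_inverse\<close>)
    then show ?thesis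
      using False by (simp add: ip_scaleC_left ip_scaleC_right norm_scaleC norm_inverse norm_divide norm_mult field_simps)
  qed
qed

lemma bounded_linear_theta: "bounded_linear (\<lambda>z. act x (ip y z))"
proof (rule bounded_linear_intro)
  show "act x (ip y (u + v)) = act x (ip y u) + act x (ip y v)" for u v
    by (simp add: ip_add_right act_add_right)
  show "act x (ip y (r *\<^sub>R u)) = r *\<^sub>R act x (ip y u)" for r u
    by (simp add: scaleR_scaleC ip_scaleC_right act_scaleC_right)
  show "norm (act x (ip y u)) \<le> norm u * (norm x * (4 * norm y))" for u
    using order_trans[OF norm_act_le mult_left_mono[OF norm_ip_le norm_ge_zero], of x y u]
    by (simp add: mult_ac)
qed

lemma theta_apply: "blinfun_apply (theta act ip x y) z = act x (ip y z)"
  by (simp add: theta_def bounded_linear_Blinfun_apply bounded_linear_theta)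

end

end

theory Submission imports Defs begin

text \<open>
  Rank one operators carry everything back and forth between \<open>N\<close> and \<open>K(N)\<close>. Write \<open>\<theta>\<close> for
  \<open>theta act ip\<close>. For \<open>T \<in> K(N)\<close> with adjoint \<open>T*\<close> there are the two rules
  \<open>T \<theta>(x, y) = \<theta>(T x, y)\<close> and \<open>\<theta>(x, y) T = \<theta>(x, T* y)\<close>; and \<open>\<theta>(x, x) = 0\<close> only for \<open>x = 0\<close>
  (lemmas \<open>comp_theta\<close>, \<open>theta_comp\<close>, \<open>theta_self_eq_0_iff\<close>).

  Essential: if \<open>M\<close> is essential and \<open>T \<noteq> 0\<close> lies in a right ideal \<open>I\<close>, then \<open>M\<close> meets the submodule
  \<open>Ran T\<close> in some \<open>m = T y \<noteq> 0\<close>, and \<open>\<theta>(m, m) = T \<theta>(y, m)\<close> is a non-zero element of \<open>I\<close> with range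
  in \<open>M\<close>. Conversely, if \<open>x \<noteq> 0\<close> lies in a submodule \<open>K\<close>, then \<open>{\<theta>(x, y) | y}\<close> is a non-zero right
  ideal, and any non-zero value of an operator in it that maps into \<open>M\<close> lies in \<open>M \<inter> K\<close>.

  Thick: if \<open>T\<close> annihilates all operators into \<open>M\<close>, then \<open>0 = T \<theta>(m, T m) = \<theta>(T m, T m)\<close> for
  \<open>m \<in> M\<close>, so \<open>T\<close> vanishes on \<open>M\<close>, that is, the range of \<open>T*\<close> is orthogonal to \<open>M\<close>. Conversely, if
  \<open>n\<close> is orthogonal to \<open>M\<close>, then \<open>\<theta>(n, n)\<close> annihilates all operators into \<open>M\<close>.

  The analysis that this needs is the existence of adjoints. It passes from the span of the
  rank one operators to its closure, because the norm of an adjoint is controlled by the norm of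
  the operator. Linearity over the algebra then comes for free with the adjoint.
\<close>

lemma complex_subspace_closure:
  fixes S :: "'b::complex_normed_vector set"
  assumes "complex_vector.subspace S"
  shows "complex_vector.subspace (closure S)"
proof (rule complex_vector.subspaceI)
  show "0 \<in> closure S"
    using assms closure_subset[of S] by (auto simp: complex_vector.subspace_def)
  show "x + y \<in> closure S" if xy: "x \<in> closure S" "y \<in> closure S" for x y
  proof -
    obtain f g where "\<And>n. f n \<in> S" "f \<longlonglongrightarrow> x" "\<And>n. g n \<in> S" "g \<longlonglongrightarrow> y"
      using xy unfolding closure_sequential by blast
    then have "\<And>n. f n + g n \<in> S" "(\<lambda>n. f n + g n) \<longlonglongrightarrow> x + y"
      using assms by (auto simp: complex_vector.subspace_def intro: tendsto_add)
    then show ?thesis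
      unfolding closure_sequential by (intro exI[of _ "\<lambda>n. f n + g n"]) simp
  qed
  show "c *\<^sub>C x \<in> closure S" if "x \<in> closure S" for c x
  proof -
    have "(*\<^sub>C) c ` S \<subseteq> S"
      using assms by (auto simp: complex_vector.subspace_def)
    then have "closure ((*\<^sub>C) c ` S) \<subseteq> closure S"
      by (rule closure_mono)
    moreover have "(*\<^sub>C) c ` closure S \<subseteq> closure ((*\<^sub>C) c ` S)"
      by (rule closure_bounded_linear_image_subset[OF bounded_linear_scaleC])
    ultimately show ?thesis
      using that by blast
  qed
qed

context hilbert_module
begin

section \<open>The inner product\<close>

lemma bounded_bilinear_ip: "bounded_bilinear ip"
proof
  show "\<exists>K. \<forall>a b. norm (ip a b) \<le> norm a * norm b * K"
    using norm_ip_le by (intro exI[of _ 4]) (simp add: mult_ac)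
qed (simp_all add: ip_add_left ip_add_right scaleR_scaleC ip_scaleC_left ip_scaleC_right)

sublocale ip: bounded_bilinear ip
  by (rule bounded_bilinear_ip)

lemma ip_act_left: "ip (act x a) y = star a * ip x y"
  by (metis ip_act_right star_ip star_mult)

lemma ip_eqI: "x = y" if "\<And>z. ip x z = ip y z"
  using that[of "x - y"] ip_definite[of "x - y"] by (simp add: ip.diff_left)

lemma act_zero: "act x 0 = 0" "act 0 a = 0"
  using act_add_right[of x 0 0] act_add_left[of 0 0 a] by simp_all

text \<open>
  Pairing \<open>x \<langle>x, x\<rangle> = 0\<close> with \<open>x\<close> gives \<open>\<langle>x, x\<rangle>\<^sup>2 = 0\<close>; the element \<open>\<langle>x, x\<rangle>\<close> is self-adjoint, so the
  C*-identity makes it vanish.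
\<close>

lemma act_ip_self_eq_0_iff: "act x (ip x x) = 0 \<longleftrightarrow> x = 0"
proof
  assume "act x (ip x x) = 0"
  then have "ip x x * ip x x = 0"
    by (metis ip_act_right ip.zero_right)
  then have "norm (ip x x) = 0"
    using cstar_identity[of "ip x x"] by (simp add: star_ip)
  then show "x = 0"
    using ip_definite by simp
qed (simp add: act_zero)

section \<open>Adjoints of compact operators\<close>

definition has_adjoint :: "('n \<Rightarrow>\<^sub>L 'n) \<Rightarrow> bool" where
  "has_adjoint T \<longleftrightarrow> (\<exists>S. \<forall>x y. ip (T x) y = ip x (S y))"

lemma has_adjoint_theta: "has_adjoint (theta act ip x y)"
  unfolding has_adjoint_def
  by (rule exI[of _ "blinfun_apply (theta act ip y x)"])
    (simp add: theta_apply ip_act_left ip_act_right star_ip)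

lemma subspace_has_adjoint: "complex_vector.subspace {T. has_adjoint T}"
proof (rule complex_vector.subspaceI; clarsimp)
  show "has_adjoint 0"
    unfolding has_adjoint_def by (rule exI[of _ "\<lambda>_. 0"]) (simp add: ip.zero_left ip.zero_right)
next
  fix T U assume "has_adjoint T" "has_adjoint U"
  then obtain S R where "\<And>x y. ip (T x) y = ip x (S y)" "\<And>x y. ip (U x) y = ip x (R y)"
    unfolding has_adjoint_def by blast
  then show "has_adjoint (T + U)"
    unfolding has_adjoint_def
    by (intro exI[of _ "\<lambda>y. S y + R y"]) (simp add: blinfun.add_left ip_add_left ip_add_right)
next
  fix c T assume "has_adjoint T"
  then obtain S where "\<And>x y. ip (T x) y = ip x (S y)"
    unfolding has_adjoint_def by blast
  then show "has_adjoint (c *\<^sub>C T)"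
    unfolding has_adjoint_def
    by (intro exI[of _ "\<lambda>y. cnj c *\<^sub>C S y"])
      (simp add: scaleC_blinfun.rep_eq ip_scaleC_left ip_scaleC_right)
qed

text \<open>
  Since \<open>\<parallel>w\<parallel>\<^sup>2 = \<parallel>\<langle>w, T* y\<rangle>\<parallel> = \<parallel>\<langle>T w, y\<rangle>\<parallel>\<close> for \<open>w = T* y\<close>, one factor \<open>\<parallel>w\<parallel>\<close> cancels.
\<close>

lemma norm_adjoint_le:
  assumes "\<And>x. ip (blinfun_apply T x) y = ip x w"
  shows "norm w \<le> 4 * norm T * norm y"
proof -
  have "norm w * norm w = norm (ip (T w) y)"
    by (simp add: assms norm_ip_self power2_eq_square)
  also have "\<dots> \<le> 4 * norm (T w) * norm y"
    by (rule norm_ip_le)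
  also have "\<dots> \<le> 4 * (norm T * norm w) * norm y"
    by (intro mult_right_mono mult_left_mono norm_blinfun) auto
  finally have "norm w * norm w \<le> (4 * norm T * norm y) * norm w"
    by (simp add: mult_ac)
  then show ?thesis
    by (cases "w = 0") simp_all
qed

text \<open>
  Apply the previous bound to the differences \<open>T\<^sub>m - T\<^sub>n\<close> of a convergent sequence: the adjoints form
  a Cauchy sequence at each point, and their pointwise limit is an adjoint of the limit.
\<close>

lemma closed_has_adjoint: "closed {T. has_adjoint T}"
  unfolding closed_sequential_limits
proof (intro allI impI; elim conjE)
  fix U T assume "\<forall>n. U n \<in> {T. has_adjoint T}" and lim: "U \<longlonglongrightarrow> T"
  then obtain S where S: "\<And>n x y. ip (U n x) y = ip x (S n y)"
    unfolding has_adjoint_def mem_Collect_eq by metis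
  have "convergent (\<lambda>n. S n y)" for y
  proof (rule Cauchy_convergent, rule metric_CauchyI)
    fix e :: real assume "0 < e"
    define d where "d = e / (4 * norm y + 1)"
    have "0 < d"
      using \<open>0 < e\<close> by (simp add: d_def add_nonneg_pos)
    then obtain k where k: "\<And>m n. k \<le> m \<Longrightarrow> k \<le> n \<Longrightarrow> dist (U m) (U n) < d"
      using LIMSEQ_imp_Cauchy[OF lim] unfolding Cauchy_def by metis
    show "\<exists>k. \<forall>m\<ge>k. \<forall>n\<ge>k. dist (S m y) (S n y) < e"
    proof (intro exI allI impI)
      fix m n assume "k \<le> m" "k \<le> n"
      have "dist (S m y) (S n y) \<le> 4 * norm (U m - U n) * norm y"
        unfolding dist_norm
        by (rule norm_adjoint_le) (simp add: blinfun.diff_left ip.diff_left ip.diff_right S)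
      also have "\<dots> \<le> 4 * d * norm y"
        using k[OF \<open>k \<le> m\<close> \<open>k \<le> n\<close>] by (intro mult_right_mono) (auto simp: dist_norm)
      also have "\<dots> < d * (4 * norm y + 1)"
        using \<open>0 < d\<close> by (simp add: algebra_simps)
      also have "\<dots> = e"
        using norm_ge_zero[of y] by (simp add: d_def add_nonneg_eq_0_iff)
      finally show "dist (S m y) (S n y) < e" .
    qed
  qed
  then have S_lim: "(\<lambda>n. S n y) \<longlonglongrightarrow> lim (\<lambda>n. S n y)" for y
    by (simp add: convergent_LIMSEQ_iff)
  have "ip (T x) y = ip x (lim (\<lambda>n. S n y))" for x y
  proof (rule LIMSEQ_unique)
    show "(\<lambda>n. ip (U n x) y) \<longlonglongrightarrow> ip (T x) y"
      by (intro ip.tendsto blinfun.tendsto lim tendsto_const)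
    show "(\<lambda>n. ip (U n x) y) \<longlonglongrightarrow> ip x (lim (\<lambda>n. S n y))"
      unfolding S by (intro ip.tendsto S_lim tendsto_const)
  qed
  then show "T \<in> {T. has_adjoint T}"
    unfolding has_adjoint_def by (auto intro!: exI[of _ "\<lambda>y. lim (\<lambda>n. S n y)"])
qed

lemma theta_compact: "theta act ip x y \<in> compact_operators act ip"
  unfolding compact_operators_def
  by (rule subsetD[OF closure_subset], rule complex_vector.span_base) blast

lemma subspace_compact_operators: "complex_vector.subspace (compact_operators act ip)"
  unfolding compact_operators_def
  by (rule complex_subspace_closure[OF complex_vector.subspace_span])

lemma closed_compact_operators: "closed (compact_operators act ip)"
  by (simp add: compact_operators_def)

lemma compact_operators_minimal:
  assumes "\<And>x y. theta act ip x y \<in> S" "complex_vector.subspace S" "closed S"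
  shows "compact_operators act ip \<subseteq> S"
  unfolding compact_operators_def
  by (rule closure_minimal[OF complex_vector.span_minimal]) (use assms in auto)

lemma has_adjoint_compact: "T \<in> compact_operators act ip \<Longrightarrow> has_adjoint T"
  using compact_operators_minimal[OF _ subspace_has_adjoint closed_has_adjoint] has_adjoint_theta
  by blast

text \<open>
  An operator with an adjoint is automatically linear over the complex numbers and over the
  algebra, since both actions can be moved to the other side of the inner product.
\<close>

lemma compact_act: "blinfun_apply T (act x a) = act (blinfun_apply T x) a"
  if T: "T \<in> compact_operators act ip"
proof -
  obtain S where "\<And>x y. ip (T x) y = ip x (S y)"
    using has_adjoint_compact[OF T] unfolding has_adjoint_def by blast
  then show ?thesis
    by (intro ip_eqI) (simp add: ip_act_left)
qed

lemma compact_scaleC: "blinfun_apply T (c *\<^sub>C x) = c *\<^sub>C blinfun_apply T x"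
  if T: "T \<in> compact_operators act ip"
proof -
  obtain S where "\<And>x y. ip (T x) y = ip x (S y)"
    using has_adjoint_compact[OF T] unfolding has_adjoint_def by blast
  then show ?thesis
    by (intro ip_eqI) (simp add: ip_scaleC_left)
qed

section \<open>Rank one operators\<close>

lemma comp_theta: "T o\<^sub>L theta act ip x y = theta act ip (blinfun_apply T x) y"
  if "T \<in> compact_operators act ip"
  using that by (intro blinfun_eqI) (simp add: theta_apply compact_act)

lemma theta_comp: "theta act ip x y o\<^sub>L T = theta act ip x (S y)"
  if "\<And>u v. ip (blinfun_apply T u) v = ip u (S v)"
proof -
  have "ip y (T z) = ip (S y) z" for z
    by (metis that star_ip)
  then show ?thesis
    by (intro blinfun_eqI) (simp add: theta_apply)
qed

lemma theta_self_eq_0_iff: "theta act ip x x = 0 \<longleftrightarrow> x = 0"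
proof
  assume "theta act ip x x = 0"
  then have "blinfun_apply (theta act ip x x) x = 0"
    by simp
  then show "x = 0"
    by (simp add: theta_apply act_ip_self_eq_0_iff)
next
  assume "x = 0"
  then show "theta act ip x x = 0"
    by (intro blinfun_eqI) (simp add: theta_apply act_zero)
qed

lemma compact_comp:
  assumes T: "T \<in> compact_operators act ip" and U: "U \<in> compact_operators act ip"
  shows "T o\<^sub>L U \<in> compact_operators act ip"
proof -
  let ?S = "(\<lambda>U. T o\<^sub>L U) -` compact_operators act ip"
  have add: "T o\<^sub>L (U + V) = (T o\<^sub>L U) + (T o\<^sub>L V)" for U V
    by (intro blinfun_eqI) (simp add: blinfun.add_left blinfun.add_right)
  have scaleC: "T o\<^sub>L (c *\<^sub>C U) = c *\<^sub>C (T o\<^sub>L U)" for c U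
    by (intro blinfun_eqI) (simp add: scaleC_blinfun.rep_eq compact_scaleC[OF T])
  have zero: "T o\<^sub>L 0 = 0"
    by (intro blinfun_eqI) (simp add: blinfun.zero_right)
  have "compact_operators act ip \<subseteq> ?S"
  proof (rule compact_operators_minimal)
    show "theta act ip x y \<in> ?S" for x y
      by (simp add: comp_theta[OF T] theta_compact)
    show "complex_vector.subspace ?S"
      using subspace_compact_operators
      by (simp add: complex_vector.subspace_def add scaleC zero)
    show "closed ?S"
      by (intro closed_vimage closed_compact_operators continuous_intros)
  qed
  with U show ?thesis by auto
qed

text \<open>
  Unlike \<open>{\<theta>(x, y) | x}\<close>, this set is invariant under composition from the right: this moves the
  second argument by the adjoint.
\<close>

lemma right_ideal_range_theta:
  "right_ideal (o\<^sub>L) (compact_operators act ip) (range (theta act ip x))"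
  unfolding right_ideal_def
proof (intro conjI ballI)
  show "range (theta act ip x) \<subseteq> compact_operators act ip"
    using theta_compact by blast
  show "complex_vector.subspace (range (theta act ip x))"
  proof (rule complex_vector.subspaceI; clarsimp?)
    have "theta act ip x 0 = 0"
      by (intro blinfun_eqI) (simp add: theta_apply ip.zero_left act_zero)
    then show "0 \<in> range (theta act ip x)"
      by (metis rangeI)
    show "theta act ip x y + theta act ip x z \<in> range (theta act ip x)" for y z
      by (rule range_eqI[of _ _ "y + z"], rule blinfun_eqI)
        (simp add: blinfun.add_left theta_apply ip_add_left act_add_right)
    show "c *\<^sub>C theta act ip x y \<in> range (theta act ip x)" for c y
      by (rule range_eqI[of _ _ "cnj c *\<^sub>C y"], rule blinfun_eqI)
        (simp add: scaleC_blinfun.rep_eq theta_apply ip_scaleC_left act_scaleC_right)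
  qed
  show "U o\<^sub>L T \<in> range (theta act ip x)"
    if "U \<in> range (theta act ip x)" "T \<in> compact_operators act ip" for U T
    using that theta_comp has_adjoint_compact[of T] unfolding has_adjoint_def by blast
qed

lemma submodule_range_compact:
  assumes T: "T \<in> compact_operators act ip"
  shows "submodule act (range (blinfun_apply T))"
  unfolding submodule_def
proof (intro conjI complex_vector.subspaceI ballI allI; clarsimp?)
  show "0 \<in> range (blinfun_apply T)"
    by (metis blinfun.zero_right rangeI)
  show "T x + T y \<in> range (blinfun_apply T)" for x y
    by (metis blinfun.add_right rangeI)
  show "c *\<^sub>C T x \<in> range (blinfun_apply T)" for c x
    by (metis compact_scaleC[OF T] rangeI)
  show "act (T x) a \<in> range (blinfun_apply T)" for x a
    by (metis compact_act[OF T] rangeI)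
qed

section \<open>Operators into a submodule\<close>

lemma theta_into: "theta act ip m y \<in> operators_into act ip M" if "submodule act M" "m \<in> M"
  using that by (auto simp: operators_into_def theta_compact theta_apply submodule_def)

lemma right_ideal_operators_into:
  assumes "submodule act M"
  shows "right_ideal (o\<^sub>L) (compact_operators act ip) (operators_into act ip M)"
proof -
  have M: "complex_vector.subspace M"
    using assms by (simp add: submodule_def)
  have "complex_vector.subspace (operators_into act ip M)"
    using M subspace_compact_operators
    by (auto simp: complex_vector.subspace_def operators_into_def image_subset_iff
        blinfun.add_left scaleC_blinfun.rep_eq)
  then show ?thesis
    unfolding right_ideal_def by (auto simp: operators_into_def compact_comp)
qed

lemma closed_operators_into:
  assumes "closed M"
  shows "closed (operators_into act ip M)"
proof -
  have "operators_into act ip M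
      = compact_operators act ip \<inter> (\<Inter>x. (\<lambda>T. blinfun_apply T x) -` M)"
    by (auto simp: operators_into_def)
  also have "closed \<dots>"
    by (intro closed_Int closed_compact_operators closed_INT ballI closed_vimage assms
        continuous_intros)
  finally show ?thesis .
qed

lemma essential_submodule_imp_right_ideal:
  assumes M: "submodule act M" and ess: "essential_submodule act M"
  shows "essential_right_ideal (o\<^sub>L) (compact_operators act ip) (operators_into act ip M)"
  unfolding essential_right_ideal_def
proof (intro allI impI, elim conjE)
  fix I assume I: "right_ideal (o\<^sub>L) (compact_operators act ip) I" and "I \<noteq> {0}"
  moreover have "0 \<in> I"
    using I by (auto simp: right_ideal_def complex_vector.subspace_def)
  ultimately obtain T where "T \<in> I" "T \<noteq> 0"
    by blast
  then have T: "T \<in> compact_operators act ip"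
    using I by (auto simp: right_ideal_def)
  have "range (blinfun_apply T) \<noteq> {0}"
    using \<open>T \<noteq> 0\<close> by (metis blinfun_eqI rangeI singletonD zero_blinfun.rep_eq)
  then have "M \<inter> range (blinfun_apply T) \<noteq> {0}"
    using ess submodule_range_compact[OF T] by (simp add: essential_submodule_def)
  moreover have "0 \<in> M \<inter> range (blinfun_apply T)"
    using M submodule_range_compact[OF T] by (simp add: submodule_def complex_vector.subspace_def)
  ultimately obtain y where y: "T y \<in> M" "T y \<noteq> 0"
    by blast
  have "T o\<^sub>L theta act ip y (T y) \<in> I"
    using I \<open>T \<in> I\<close> theta_compact by (simp add: right_ideal_def)
  then have "theta act ip (T y) (T y) \<in> operators_into act ip M \<inter> I"
    using theta_into[OF M y(1)] by (simp add: comp_theta[OF T])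
  moreover have "theta act ip (T y) (T y) \<noteq> 0"
    using y(2) by (simp add: theta_self_eq_0_iff)
  ultimately show "operators_into act ip M \<inter> I \<noteq> {0}"
    by blast
qed

lemma essential_right_ideal_imp_submodule:
  assumes M: "submodule act M"
    and ess: "essential_right_ideal (o\<^sub>L) (compact_operators act ip) (operators_into act ip M)"
  shows "essential_submodule act M"
  unfolding essential_submodule_def
proof (intro allI impI, elim conjE)
  fix K assume K: "submodule act K" and "K \<noteq> {0}"
  moreover have "0 \<in> K"
    using K by (auto simp: submodule_def complex_vector.subspace_def)
  ultimately obtain x where x: "x \<in> K" "x \<noteq> 0"
    by blast
  let ?I = "range (theta act ip x)"
  have "?I \<noteq> {0}"
    using x(2) theta_self_eq_0_iff[of x] by blast
  then have "operators_into act ip M \<inter> ?I \<noteq> {0}"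
    using ess right_ideal_range_theta by (simp add: essential_right_ideal_def)
  moreover have "0 \<in> operators_into act ip M \<inter> ?I"
    using right_ideal_operators_into[OF M] right_ideal_range_theta[of x]
    by (simp add: right_ideal_def complex_vector.subspace_def)
  ultimately obtain y where y: "theta act ip x y \<in> operators_into act ip M" "theta act ip x y \<noteq> 0"
    by blast
  then obtain z where "act x (ip y z) \<noteq> 0"
    by (metis blinfun_eqI theta_apply zero_blinfun.rep_eq)
  moreover have "act x (ip y z) \<in> M"
    using y(1) by (auto simp: operators_into_def theta_apply)
  moreover have "act x (ip y z) \<in> K"
    using K x(1) by (simp add: submodule_def)
  ultimately show "M \<inter> K \<noteq> {0}"
    by blast
qed

lemma thick_submodule_imp_right_ideal:
  assumes M: "submodule act M" and thick: "thick_submodule ip M"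
  shows "thick_right_ideal (o\<^sub>L) (compact_operators act ip) (operators_into act ip M)"
  unfolding thick_right_ideal_def
proof (intro ballI impI)
  fix T assume T: "T \<in> compact_operators act ip" and ann: "\<forall>U\<in>operators_into act ip M. T o\<^sub>L U = 0"
  have vanish: "T m = 0" if "m \<in> M" for m
    using ann theta_into[OF M that, of "T m"] comp_theta[OF T, of m "T m"]
    by (simp add: theta_self_eq_0_iff)
  obtain S where S: "\<And>x y. ip (T x) y = ip x (S y)"
    using has_adjoint_compact[OF T] unfolding has_adjoint_def by blast
  have "S y = 0" for y
  proof -
    have "ip (S y) m = 0" if "m \<in> M" for m
      by (metis S star_ip vanish[OF that] ip.zero_right)
    then show ?thesis
      using thick unfolding thick_submodule_def by blast
  qed
  then show "T = 0"
    by (intro blinfun_eqI ip_eqI) (simp add: S ip.zero_left ip.zero_right)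
qed

lemma thick_right_ideal_imp_submodule:
  assumes "thick_right_ideal (o\<^sub>L) (compact_operators act ip) (operators_into act ip M)"
  shows "thick_submodule ip M"
proof -
  have "n = 0" if n: "\<forall>m\<in>M. ip n m = 0" for n
  proof -
    have "theta act ip n n o\<^sub>L U = 0" if "U \<in> operators_into act ip M" for U
      using that n by (intro blinfun_eqI) (auto simp: operators_into_def theta_apply act_zero image_subset_iff)
    then have "theta act ip n n = 0"
      using assms theta_compact by (simp add: thick_right_ideal_def)
    then show ?thesis
      by (simp add: theta_self_eq_0_iff)
  qed
  then show ?thesis
    by (auto simp: thick_submodule_def ip.zero_left)
qed

end

theorem theorem6p1:
  fixes act :: "'n::complex_banach \<Rightarrow> 'a::cstar_algebra \<Rightarrow> 'n"
    and ip :: "'n \<Rightarrow> 'n \<Rightarrow> 'a"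
    and M :: "'n set"
  assumes "hilbert_module act ip"
    and "submodule act M" and "closed M"
  shows "right_ideal (o\<^sub>L) (compact_operators act ip) (operators_into act ip M)
    \<and> closed (operators_into act ip M)
    \<and> (essential_submodule act M \<longleftrightarrow>
         essential_right_ideal (o\<^sub>L) (compact_operators act ip) (operators_into act ip M))
    \<and> (thick_submodule ip M \<longleftrightarrow>
         thick_right_ideal (o\<^sub>L) (compact_operators act ip) (operators_into act ip M))"
proof -
  interpret hilbert_module act ip
    by (rule assms(1))
  show ?thesis
    using right_ideal_operators_into[OF assms(2)] closed_operators_into[OF assms(3)]
      essential_submodule_imp_right_ideal[OF assms(2)]
      essential_right_ideal_imp_submodule[OF assms(2)]
      thick_submodule_imp_right_ideal[OF assms(2)] thick_right_ideal_imp_submodule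
    by blast
qed

end
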